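(* Let $m \ge 1$ be a fixed integer, let $n\ge 1$, and let $\pi=(\pi_1,\dots,\pi_n) \in S_n$ be a permutation that avoids the pattern $132$ and satisfies $|\pi_{i+1}-\pi_i| \le m$ for all $1 \le i < n$. If $\pi_k = n$, then $k \in \{1,2,\dots,m\} \cup \{n\}$.
   Context: $S_n$ is the set of permutations of $\{1,\dots,n\}$ written in one-line notation. A permutation $\pi\in S_n$ avoids $132$ if there are no indices $i<j<k$ with $\pi_i<\pi_k<\pi_j$. *)

theory Defs
  imports "HOL-Combinatorics.Permutations"
begin

definition avoids_132 :: "nat \<Rightarrow> (nat \<Rightarrow> nat) \<Rightarrow> bool" where
  "avoids_132 n \<pi> \<longleftrightarrow>
     \<not> (\<exists>i j k. 1 \<le> i \<and> i < j \<and> j < k \<and> k \<le> n \<and> \<pi> i < \<pi> k \<and> \<pi> k < \<pi> j)"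

end

(* If k < n, avoidance of 132 forces the first k values to exceed \<pi> (k + 1), so these k
   distinct values lie in {\<pi> (k + 1) + 1..n}, which has at most m elements since
   \<pi> k = n and \<pi> (k + 1) differ by at most m. *)
theory Submission
  imports Defs
begin

theorem theorem2p3:
  fixes m n k :: nat and \<pi> :: "nat \<Rightarrow> nat"
  assumes "m \<ge> 1" and "n \<ge> 1"
    and "\<pi> permutes {1..n}"
    and "avoids_132 n \<pi>"
    and "\<And>i. 1 \<le> i \<Longrightarrow> i < n \<Longrightarrow> \<bar>int (\<pi> (i + 1)) - int (\<pi> i)\<bar> \<le> int m"
    and "k \<in> {1..n}" and "\<pi> k = n"
  shows "k \<in> {1..m} \<union> {n}"
proof (cases "k = n")
  case False
  with assms(6) have k: "1 \<le> k" "k < n" by auto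
  have inj: "inj \<pi>" using assms(3) by (rule permutes_inj)
  have range: "\<pi> i \<le> n" if "1 \<le> i" "i \<le> n" for i
    using permutes_in_image[OF assms(3), of i] that by simp
  \<comment> \<open>Strictness in \<open>next_lt\<close> serves twice below: it settles the case
    \<open>i = k\<close> and supplies the descent from \<open>k\<close> to \<open>k + 1\<close> in a
    132 pattern.\<close>
  have "\<pi> (k + 1) \<noteq> n" using injD[OF inj, of "k + 1" k] assms(7) by auto
  with range[of "k + 1"] k have next_lt: "\<pi> (k + 1) < n" by simp
  have "\<pi> (k + 1) < \<pi> i" if i: "1 \<le> i" "i \<le> k" for i
  proof (cases "i = k")
    case True
    then show ?thesis using next_lt assms(7) by simp
  next
    case False
    with i have "i < k" by simp
    \<comment> \<open>Otherwise the positions \<open>i < k < k + 1\<close> form a 132 pattern, with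
      \<open>\<pi> k = n\<close> as its peak.\<close>
    then have "\<not> \<pi> i < \<pi> (k + 1)"
      using assms(4,7) next_lt k i unfolding avoids_132_def
      by (metis Suc_eq_plus1 Suc_leI lessI)
    moreover have "\<pi> i \<noteq> \<pi> (k + 1)" using injD[OF inj, of i "k + 1"] i by auto
    ultimately show ?thesis by simp
  qed
  then have "\<pi> ` {1..k} \<subseteq> {\<pi> (k + 1) + 1..n}"
    using range k by (auto simp: Suc_le_eq)
  \<comment> \<open>By injectivity the image has exactly \<open>k\<close> elements, and the interval
    has \<open>n - \<pi> (k + 1)\<close>.\<close>
  from card_mono[OF _ this] have "k \<le> n - \<pi> (k + 1)"
    using card_image[OF inj_on_subset[OF inj subset_UNIV], of "{1..k}"] by simp
  moreover have "n - \<pi> (k + 1) \<le> m" using assms(5)[OF k] assms(7) by linarith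
  ultimately show ?thesis using k by simp
qed simp

end
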